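(* Let $\varphi\in H^{\infty}(\mathbb{D})$, let $M\subset H^{2}(\mathbb{D}^{2})$ be a $T_{\varphi}^{*}$-invariant subspace, and suppose that for some $n\in\mathbb{N}$ the subspace $P_{n}(M)$ is closed and $\dim P_{n}(M)=\infty$. If for every $t_{\varphi}^{*}$-invariant subspace $V\subset H^{2}(\mathbb{D})$ the operator $t_{\varphi}^{*}|_{V}$ has a nontrivial invariant subspace, then $T_{\varphi}^{*}|_{M}$ has a nontrivial invariant subspace.
   Context: $\mathbb{D}$ is the open unit disk and $H^{2}(\mathbb{D}^{2})$ is the Hardy space over the bidisk, in the variables $(z,w)$; every $g\in H^{2}(\mathbb{D}^{2})$ is written $g(z,w)=\sum_{n\ge0}g_{n}(z)w^{n}$ with $g_{n}\in H^{2}(z)$ (the Hardy space of the disk in the variable $z$) and $\|g\|^{2}=\sum_{n}\|g_{n}\|^{2}$. A function $\varphi\in H^{\infty}(\mathbb{D})$ is regarded as a function of $z$ on $\mathbb{D}^{2}$; $T_{\varphi}f=\varphi f$ on $H^{2}(\mathbb{D}^{2})$ and $t_{\varphi}f=\varphi f$ on $H^{2}(\mathbb{D})$ are the Toeplitz operators, with adjoints $T_{\varphi}^{*}$, $t_{\varphi}^{*}$. $H_{n}=H^{2}(z)w^{n}$, and $P_{n}$ is the orthogonal projection of $H^{2}(\mathbb{D}^{2})$ onto $H_{n}$, i.e. $P_ng=g_nw^n$, for $n\in\mathbb{N}=\{0,1,2,\dots\}$. Invariant subspaces are closed; an invariant subspace $N$ of an operator on a space $W$ is nontrivial if $\{0\}\neq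 N\neq W$. *)

theory Defs
  imports "HOL-Analysis.Analysis" "HOL-Library.Function_Algebras"
begin

definition cscale :: "complex \<Rightarrow> ('a \<Rightarrow> complex) \<Rightarrow> 'a \<Rightarrow> complex" where
  "cscale c f = (\<lambda>x. c * f x)"

interpretation cfun: vector_space "cscale :: complex \<Rightarrow> ('a \<Rightarrow> complex) \<Rightarrow> 'a \<Rightarrow> complex"
  by unfold_locales (auto simp: cscale_def fun_eq_iff algebra_simps)

definition infinite_dimensional :: "('a \<Rightarrow> complex) set \<Rightarrow> bool" where
  "infinite_dimensional V \<longleftrightarrow> \<not> (\<exists>B. finite B \<and> B \<subseteq> V \<and> cfun.span B = V)"

text \<open>
  A space is given by its carrier \<open>W\<close> and a complex inner product \<open>ip\<close>, linear in the first
  argument. Both \<open>ip\<close> and the operators are total functions; only their values on \<open>W\<close> matter.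
\<close>

type_synonym 'a inner = "('a \<Rightarrow> complex) \<Rightarrow> ('a \<Rightarrow> complex) \<Rightarrow> complex"

definition ip_norm :: "'a inner \<Rightarrow> ('a \<Rightarrow> complex) \<Rightarrow> real" where
  "ip_norm ip f = sqrt (Re (ip f f))"

definition norm_closed :: "('a \<Rightarrow> complex) set \<Rightarrow> 'a inner \<Rightarrow> ('a \<Rightarrow> complex) set \<Rightarrow> bool" where
  "norm_closed W ip V \<longleftrightarrow> V \<subseteq> W \<and>
     (\<forall>s f. (\<forall>k::nat. s k \<in> V) \<and> f \<in> W \<and> (\<lambda>k. ip_norm ip (s k - f)) \<longlonglongrightarrow> 0 \<longrightarrow> f \<in> V)"

definition adjoint_on :: "('a \<Rightarrow> complex) set \<Rightarrow> 'a inner \<Rightarrow>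
    (('a \<Rightarrow> complex) \<Rightarrow> 'a \<Rightarrow> complex) \<Rightarrow> ('a \<Rightarrow> complex) \<Rightarrow> 'a \<Rightarrow> complex" where
  "adjoint_on W ip T g = (THE h. h \<in> W \<and> (\<forall>f\<in>W. ip (T f) g = ip f h))"

definition invariant_subspace :: "('a \<Rightarrow> complex) set \<Rightarrow> 'a inner \<Rightarrow>
    (('a \<Rightarrow> complex) \<Rightarrow> 'a \<Rightarrow> complex) \<Rightarrow> ('a \<Rightarrow> complex) set \<Rightarrow> bool" where
  "invariant_subspace W ip T N \<longleftrightarrow> cfun.subspace N \<and> norm_closed W ip N \<and> T ` N \<subseteq> N"

text \<open>
  For the restriction of \<open>T\<close> to an invariant subspace \<open>V\<close>, take \<open>V\<close> itself as the carrier.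
\<close>

definition has_nontrivial_invariant_subspace :: "('a \<Rightarrow> complex) set \<Rightarrow> 'a inner \<Rightarrow>
    (('a \<Rightarrow> complex) \<Rightarrow> 'a \<Rightarrow> complex) \<Rightarrow> bool" where
  "has_nontrivial_invariant_subspace W ip T \<longleftrightarrow>
     (\<exists>N. invariant_subspace W ip T N \<and> N \<noteq> {0} \<and> N \<noteq> W)"

text \<open>
  Elements of the Hardy spaces are total functions that vanish off the domain, so that equality
  on the domain is equality of functions.
\<close>

abbreviation unit_disk :: "complex set" where
  "unit_disk \<equiv> ball 0 1"

definition taylor_coeff :: "(complex \<Rightarrow> complex) \<Rightarrow> nat \<Rightarrow> complex" where
  "taylor_coeff f n = (deriv ^^ n) f 0 / fact n"

definition H2 :: "(complex \<Rightarrow> complex) set" where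
  "H2 = {f. f holomorphic_on unit_disk \<and> (\<forall>z. z \<notin> unit_disk \<longrightarrow> f z = 0) \<and>
            summable (\<lambda>n. (cmod (taylor_coeff f n))\<^sup>2)}"

definition H2_inner :: "complex inner" where
  "H2_inner f g = (\<Sum>n. taylor_coeff f n * cnj (taylor_coeff g n))"

definition Hinf :: "(complex \<Rightarrow> complex) set" where
  "Hinf = {\<phi>. \<phi> holomorphic_on unit_disk \<and> bounded (\<phi> ` unit_disk)}"

text \<open>
  The coefficient \<open>g\<^sub>n\<close> in \<open>g(z,w) = \<Sum>\<^sub>n g\<^sub>n(z) w\<^sup>n\<close>; it vanishes off the disk if \<open>g\<close> vanishes off
  the bidisk.
\<close>

definition w_coeff :: "(complex \<times> complex \<Rightarrow> complex) \<Rightarrow> nat \<Rightarrow> complex \<Rightarrow> complex" where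
  "w_coeff g n = (\<lambda>z. taylor_coeff (\<lambda>w. g (z, w)) n)"

definition H2_bidisk :: "(complex \<times> complex \<Rightarrow> complex) set" where
  "H2_bidisk = {g. (\<forall>p. p \<notin> unit_disk \<times> unit_disk \<longrightarrow> g p = 0) \<and>
     (\<forall>n. w_coeff g n \<in> H2) \<and> summable (\<lambda>n. (ip_norm H2_inner (w_coeff g n))\<^sup>2) \<and>
     (\<forall>z\<in>unit_disk. \<forall>w\<in>unit_disk. (\<lambda>n. w_coeff g n z * w ^ n) sums g (z, w))}"

definition H2_bidisk_inner :: "(complex \<times> complex) inner" where
  "H2_bidisk_inner f g = (\<Sum>n. H2_inner (w_coeff f n) (w_coeff g n))"

text \<open>The orthogonal projection of \<open>H2_bidisk\<close> onto \<open>H\<^sub>n = H\<^sup>2(z) w\<^sup>n\<close>, given by \<open>g \<mapsto> g\<^sub>n w\<^sup>n\<close>.\<close>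

definition proj_w :: "nat \<Rightarrow> (complex \<times> complex \<Rightarrow> complex) \<Rightarrow> complex \<times> complex \<Rightarrow> complex" where
  "proj_w n g = (\<lambda>(z, w). if z \<in> unit_disk \<and> w \<in> unit_disk then w_coeff g n z * w ^ n else 0)"

definition toeplitz_disk :: "(complex \<Rightarrow> complex) \<Rightarrow> (complex \<Rightarrow> complex) \<Rightarrow> complex \<Rightarrow> complex" where
  "toeplitz_disk \<phi> f = (\<lambda>z. \<phi> z * f z)"

definition toeplitz_bidisk :: "(complex \<Rightarrow> complex) \<Rightarrow>
    (complex \<times> complex \<Rightarrow> complex) \<Rightarrow> complex \<times> complex \<Rightarrow> complex" where
  "toeplitz_bidisk \<phi> g = (\<lambda>(z, w). \<phi> z * g (z, w))"

definition toeplitz_disk_adj :: "(complex \<Rightarrow> complex) \<Rightarrow> (complex \<Rightarrow> complex) \<Rightarrow> complex \<Rightarrow> complex" where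
  "toeplitz_disk_adj \<phi> = adjoint_on H2 H2_inner (toeplitz_disk \<phi>)"

definition toeplitz_bidisk_adj :: "(complex \<Rightarrow> complex) \<Rightarrow>
    (complex \<times> complex \<Rightarrow> complex) \<Rightarrow> complex \<times> complex \<Rightarrow> complex" where
  "toeplitz_bidisk_adj \<phi> = adjoint_on H2_bidisk H2_bidisk_inner (toeplitz_bidisk \<phi>)"

end

(* The operator T_phi^* acts on each w-coefficient separately: the n-th coefficient of T_phi^* g is
   t_phi^* g_n. Hence V = {g_n | g in M} is t_phi^*-invariant; it is closed and infinite-dimensional
   because g_n w^n <-> g_n identifies it isometrically with P_n(M). If N is a nontrivial
   t_phi^*-invariant subspace of V, then {g in M | g_n in N} is one of T_phi^* in M.

   Adjoints are given by a definite description, so their existence is needed. On Taylor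
   coefficients t_phi is a lower triangular Toeplitz matrix, bounded by sup |phi| (compare mean
   squares on circles), and its conjugate transpose defines the adjoint; on the bidisk the adjoint is
   assembled coefficientwise. *)

theory Submission imports Defs "HOL-Complex_Analysis.Complex_Analysis" begin

section \<open>Square-summable sequences\<close>

definition ell2 :: "(nat \<Rightarrow> complex) \<Rightarrow> bool" where
  "ell2 a \<longleftrightarrow> summable (\<lambda>k. (cmod (a k))\<^sup>2)"

lemma ell2_bounded_sums:
  assumes "\<And>K. (\<Sum>k<K. (cmod (a k))\<^sup>2) \<le> B"
  shows "ell2 a" "(\<Sum>k. (cmod (a k))\<^sup>2) \<le> B"
proof -
  show *: "ell2 a" unfolding ell2_def
    by (rule summableI_nonneg_bounded[where x = B]) (use assms in auto)
  show "(\<Sum>k. (cmod (a k))\<^sup>2) \<le> B"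
    using * unfolding ell2_def by (rule suminf_le_const) (use assms in auto)
qed

lemma ell2_sum_le:
  assumes "ell2 a" shows "(\<Sum>k<K. (cmod (a k))\<^sup>2) \<le> (\<Sum>k. (cmod (a k))\<^sup>2)"
  using assms unfolding ell2_def by (intro sum_le_suminf) auto

lemma ell2_finite_support:
  assumes "\<And>k. k \<ge> K \<Longrightarrow> a k = 0" shows "ell2 a"
  unfolding ell2_def by (rule summable_finite[of "{..<K}"]) (use assms in \<open>auto simp: not_less\<close>)

lemma norm_add_sq_le: "(cmod (x + y))\<^sup>2 \<le> 2 * (cmod x)\<^sup>2 + 2 * (cmod y)\<^sup>2"
proof -
  have "(cmod (x + y))\<^sup>2 \<le> (cmod x + cmod y)\<^sup>2"
    by (intro power_mono norm_triangle_ineq) auto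
  also have "\<dots> \<le> 2 * (cmod x)\<^sup>2 + 2 * (cmod y)\<^sup>2"
    using zero_le_power2[of "cmod x - cmod y"] by (simp add: power2_eq_square algebra_simps)
  finally show ?thesis .
qed

lemma ell2_add:
  assumes "ell2 a" "ell2 b" shows "ell2 (\<lambda>k. a k + b k)"
proof -
  have "summable (\<lambda>k. 2 * (cmod (a k))\<^sup>2 + 2 * (cmod (b k))\<^sup>2)"
    using assms unfolding ell2_def by (intro summable_add summable_mult)
  then show ?thesis unfolding ell2_def
    by (rule summable_comparison_test') (simp add: norm_add_sq_le)
qed

lemma ell2_cmult: "ell2 a \<Longrightarrow> ell2 (\<lambda>k. c * a k)"
  unfolding ell2_def by (simp add: norm_mult power_mult_distrib summable_mult)

lemma ell2_diff: "ell2 a \<Longrightarrow> ell2 b \<Longrightarrow> ell2 (\<lambda>k. a k - b k)"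
  using ell2_add[OF _ ell2_cmult, of a b "-1"] by simp

lemma ell2_shift: "ell2 a \<Longrightarrow> ell2 (\<lambda>k. a (k + i))"
  unfolding ell2_def by (rule summable_ignore_initial_segment)

lemma ell2_summable_norm_mult_cnj:
  assumes "ell2 a" "ell2 b" shows "summable (\<lambda>k. cmod (a k * cnj (b k)))"
proof (rule summable_comparison_test'[OF summable_add])
  show "summable (\<lambda>k. (cmod (a k))\<^sup>2)" "summable (\<lambda>k. (cmod (b k))\<^sup>2)"
    using assms by (auto simp: ell2_def)
  fix k
  have "cmod (a k) * cmod (b k) \<le> (cmod (a k))\<^sup>2 + (cmod (b k))\<^sup>2"
    using zero_le_power2[of "cmod (a k) - cmod (b k)"] zero_le_power2[of "cmod (a k)"]
      zero_le_power2[of "cmod (b k)"]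
    unfolding power2_diff by linarith
  then show "norm (cmod (a k * cnj (b k))) \<le> (cmod (a k))\<^sup>2 + (cmod (b k))\<^sup>2"
    by (simp add: norm_mult)
qed

lemma ell2_summable_mult_cnj: "ell2 a \<Longrightarrow> ell2 b \<Longrightarrow> summable (\<lambda>k. a k * cnj (b k))"
  by (rule summable_norm_cancel[OF ell2_summable_norm_mult_cnj])

text \<open>The finite Cauchy-Schwarz inequality bounds every partial sum, and the bound passes to
  the limit.\<close>

lemma ell2_Cauchy_Schwarz:
  assumes "ell2 a" "ell2 b"
  shows "(cmod (\<Sum>k. a k * cnj (b k)))\<^sup>2 \<le> (\<Sum>k. (cmod (a k))\<^sup>2) * (\<Sum>k. (cmod (b k))\<^sup>2)"
proof -
  have lim: "(\<lambda>K. (cmod (\<Sum>k<K. a k * cnj (b k)))\<^sup>2) \<longlonglongrightarrow> (cmod (\<Sum>k. a k * cnj (b k)))\<^sup>2"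
    using ell2_summable_mult_cnj[OF assms] by (intro tendsto_intros summable_LIMSEQ)
  have "(cmod (\<Sum>k<K. a k * cnj (b k)))\<^sup>2
      \<le> (\<Sum>k. (cmod (a k))\<^sup>2) * (\<Sum>k. (cmod (b k))\<^sup>2)" for K
  proof -
    have "(cmod (\<Sum>k<K. a k * cnj (b k)))\<^sup>2 \<le> (\<Sum>k<K. cmod (a k) * cmod (b k))\<^sup>2"
      by (intro power_mono order_trans[OF norm_sum]) (auto simp: norm_mult)
    also have "\<dots> \<le> (\<Sum>k<K. (cmod (a k))\<^sup>2) * (\<Sum>k<K. (cmod (b k))\<^sup>2)"
      by (rule Cauchy_Schwarz_ineq_sum)
    also have "\<dots> \<le> (\<Sum>k. (cmod (a k))\<^sup>2) * (\<Sum>k. (cmod (b k))\<^sup>2)"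
      using assms by (intro mult_mono ell2_sum_le sum_nonneg suminf_nonneg) (auto simp: ell2_def)
    finally show ?thesis .
  qed
  then show ?thesis by (intro LIMSEQ_le_const2[OF lim]) blast
qed

section \<open>Taylor coefficients of holomorphic functions on the disk\<close>

lemma taylor_sums:
  assumes "f holomorphic_on unit_disk" "z \<in> unit_disk"
  shows "(\<lambda>k. taylor_coeff f k * z ^ k) sums f z"
  using holomorphic_power_series[OF assms] by (simp add: taylor_coeff_def)

text \<open>Convergence near 0 gives a formal power series expansion, whose coefficients are unique.
  Later Taylor coefficients are mostly found by exhibiting a convergent series and applying
  this.\<close>

lemma power_series_disk:
  assumes "\<And>z. z \<in> unit_disk \<Longrightarrow> (\<lambda>k. c k * z ^ k) sums f z"
  shows "f holomorphic_on unit_disk" "taylor_coeff f = c"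
proof -
  show "f holomorphic_on unit_disk"
    by (rule power_series_holomorphic[of 0 1 c]) (use assms in auto)
  have "eventually (\<lambda>u. (\<lambda>n. fps_nth (Abs_fps c) n * u ^ n) sums f u) (nhds 0)"
    by (rule eventually_mono[OF eventually_nhds_in_open[of unit_disk 0]]) (use assms in auto)
  then have "f has_fps_expansion Abs_fps c" by (rule has_fps_expansionI)
  from fps_nth_fps_expansion[OF this] show "taylor_coeff f = c"
    by (auto simp: taylor_coeff_def fun_eq_iff)
qed

lemma has_fps_expansion_taylor:
  assumes "f holomorphic_on unit_disk"
  shows "f has_fps_expansion Abs_fps (taylor_coeff f)"
proof (rule has_fps_expansionI)
  show "eventually (\<lambda>u. (\<lambda>n. fps_nth (Abs_fps (taylor_coeff f)) n * u ^ n) sums f u) (nhds 0)"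
    by (rule eventually_mono[OF eventually_nhds_in_open[of unit_disk 0]])
       (use taylor_sums[OF assms] in auto)
qed

lemma taylor_coeff_zero: "taylor_coeff (\<lambda>z. 0) k = 0"
  using fps_nth_fps_expansion[OF has_fps_expansion_0] by (simp add: taylor_coeff_def)

lemma taylor_coeff_add:
  assumes "f holomorphic_on unit_disk" "g holomorphic_on unit_disk"
  shows "taylor_coeff (\<lambda>z. f z + g z) k = taylor_coeff f k + taylor_coeff g k"
  by (rule fun_cong[OF power_series_disk(2)])
     (use sums_add[OF taylor_sums taylor_sums] assms in \<open>auto simp: ring_distribs\<close>)

lemma taylor_coeff_cmult:
  assumes "f holomorphic_on unit_disk"
  shows "taylor_coeff (\<lambda>z. c * f z) k = c * taylor_coeff f k"
  by (rule fun_cong[OF power_series_disk(2)])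
     (use sums_mult[OF taylor_sums] assms in \<open>auto simp: mult.assoc\<close>)

text \<open>For fixed \<open>a\<close> this is the lower triangular Toeplitz matrix with entries
  \<open>a (k - i)\<close> acting on \<open>c\<close>: multiplication by a function, seen on Taylor
  coefficients.\<close>

definition convol :: "(nat \<Rightarrow> complex) \<Rightarrow> (nat \<Rightarrow> complex) \<Rightarrow> nat \<Rightarrow> complex" where
  "convol a c k = (\<Sum>i=0..k. a i * c (k - i))"

lemma taylor_coeff_mult:
  assumes "f holomorphic_on unit_disk" "g holomorphic_on unit_disk"
  shows "taylor_coeff (\<lambda>z. f z * g z) k = convol (taylor_coeff f) (taylor_coeff g) k"
  using fps_nth_fps_expansion[OF has_fps_expansion_mult[OF assms[THEN has_fps_expansion_taylor]], of k]
  by (simp add: taylor_coeff_def convol_def fps_mult_nth)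

lemma circle_in_disk: "0 < r \<Longrightarrow> r < 1 \<Longrightarrow> complex_of_real r * cis t \<in> unit_disk"
  by (simp add: norm_mult)

text \<open>Cauchy's formula for the k-th derivative, parametrized over [0,1]: the integral is the
  k-th Fourier coefficient of \<open>f\<close> on the circle of radius \<open>r\<close>.\<close>

lemma cauchy_coeff:
  assumes "f holomorphic_on unit_disk" "0 < r" "r < 1"
  shows "((\<lambda>t. f (of_real r * cis (2*pi*t)) * cnj (cis (2*pi*t) ^ k))
            has_integral taylor_coeff f k * of_real r ^ k) {0..1}"
proof -
  have sub: "cball 0 r \<subseteq> unit_disk" using assms by auto
  have "((\<lambda>u. f u / (u - 0) ^ Suc k) has_contour_integral (2 * pi * \<i>) / fact k * (deriv ^^ k) f 0)
          (circlepath 0 r)"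
  proof (rule Cauchy_has_contour_integral_higher_derivative_circlepath)
    show "continuous_on (cball 0 r) f"
      using assms(1) sub holomorphic_on_imp_continuous_on holomorphic_on_subset by blast
    show "f holomorphic_on ball 0 r"
      using assms(1) sub by (meson ball_subset_cball holomorphic_on_subset)
  qed (use assms in auto)
  then have "((\<lambda>u. f u / u ^ Suc k) has_contour_integral 2 * pi * \<i> * taylor_coeff f k)
          (circlepath 0 r)"
    by (simp add: taylor_coeff_def)
  then have "((\<lambda>t. f (circlepath 0 r t) / circlepath 0 r t ^ Suc k *
         (2 * pi * \<i> * r * exp (2 * of_real pi * \<i> * of_real t))) has_integral 2 * pi * \<i> * taylor_coeff f k) {0..1}"
    unfolding has_contour_integral_def
    by (rule has_integral_eq[rotated]) (simp only: vector_derivative_circlepath01 atLeastAtMost_iff)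
  then have *: "((\<lambda>t. of_real r ^ k / (2 * pi * \<i>) * (f (circlepath 0 r t) / circlepath 0 r t ^ Suc k *
         (2 * pi * \<i> * r * exp (2 * of_real pi * \<i> * of_real t)))) has_integral
         of_real r ^ k / (2 * pi * \<i>) * (2 * pi * \<i> * taylor_coeff f k)) {0..1}"
    by (rule has_integral_mult_right)
  \<comment> \<open>Here \<open>A\<close> is 2 \<pi> i, \<open>R\<close> the radius and
    \<open>e\<close> the point on the unit circle. The factor \<open>A * R * e\<close> is the
    velocity of the path.\<close>
  have cancel: "R ^ k / A * (F / (R * e) ^ Suc k * (A * R * e)) = F * inverse e ^ k"
    if "A \<noteq> 0" "R \<noteq> 0" "e \<noteq> 0" for A R e F :: complex
  proof -
    have "R ^ k / A * (F / (R * e) ^ Suc k * (A * R * e)) = F * ((A * (R * R ^ k * e)) / (A * (R * R ^ k * e))) * (1 / e ^ k)"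
      by (simp add: power_mult_distrib)
    also have "\<dots> = F * inverse e ^ k"
      using that by (simp add: power_inverse divide_inverse)
    finally show ?thesis .
  qed
  have eq1: "of_real r ^ k / (2 * pi * \<i>) * (f (circlepath 0 r t) / circlepath 0 r t ^ Suc k *
         (2 * pi * \<i> * r * exp (2 * of_real pi * \<i> * of_real t)))
       = f (of_real r * cis (2*pi*t)) * cnj (cis (2*pi*t) ^ k)" for t
  proof -
    define e where "e = cis (2*pi*t)"
    have e: "exp (2 * of_real pi * \<i> * of_real t) = e" "circlepath 0 r t = of_real r * e"
      unfolding e_def circlepath cis_conv_exp by (simp_all add: mult_ac)
    have c: "cnj e = inverse e" and "e \<noteq> 0" by (simp_all add: e_def cis_cnj)
    then show ?thesis
      unfolding e e_def[symmetric] complex_cnj_power c using assms by (intro cancel) auto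
  qed
  have eq2: "of_real r ^ k / (2 * pi * \<i>) * (2 * pi * \<i> * taylor_coeff f k)
      = taylor_coeff f k * of_real r ^ k"
    by (simp add: field_simps)
  show ?thesis using * unfolding eq1 eq2 .
qed

section \<open>The coefficient matrix of a bounded multiplier\<close>

lemma taylor_coeff_polynomial:
  "(\<lambda>z. \<Sum>k<K. c k * z ^ k) holomorphic_on unit_disk"
  "taylor_coeff (\<lambda>z. \<Sum>k<K. c k * z ^ k) k = (if k < K then c k else 0)"
proof -
  have "(\<lambda>k. (if k < K then c k else 0) * z ^ k) sums (\<Sum>k<K. c k * z ^ k)" for z :: complex
    using sums_finite[of "{..<K}" "\<lambda>k. (if k < K then c k else 0) * z ^ k"] by auto
  note power_series_disk[OF this]
  then show "(\<lambda>z. \<Sum>k<K. c k * z ^ k) holomorphic_on unit_disk"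
    "taylor_coeff (\<lambda>z. \<Sum>k<K. c k * z ^ k) k = (if k < K then c k else 0)"
    by simp_all
qed

text \<open>A finite linear combination of \<open>cauchy_coeff\<close>: pairing with a trigonometric
  polynomial of degree below \<open>K\<close> sees only the first \<open>K\<close> coefficients of
  \<open>f\<close>.\<close>

lemma circle_pairing:
  assumes "f holomorphic_on unit_disk" "0 < r" "r < 1"
  shows "((\<lambda>t. f (of_real r * cis (2*pi*t)) * cnj (\<Sum>k<K. d k * cis (2*pi*t) ^ k))
            has_integral (\<Sum>k<K. cnj (d k) * (taylor_coeff f k * of_real r ^ k))) {0..1}"
proof -
  have "((\<lambda>t. \<Sum>k<K. cnj (d k) * (f (of_real r * cis (2*pi*t)) * cnj (cis (2*pi*t) ^ k)))
            has_integral (\<Sum>k<K. cnj (d k) * (taylor_coeff f k * of_real r ^ k))) {0..1}"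
    by (intro has_integral_sum has_integral_mult_right cauchy_coeff assms) auto
  moreover have "(\<Sum>k<K. cnj (d k) * (f (of_real r * cis (2*pi*t)) * cnj (cis (2*pi*t) ^ k)))
      = f (of_real r * cis (2*pi*t)) * cnj (\<Sum>k<K. d k * cis (2*pi*t) ^ k)" for t
    unfolding cnj_sum sum_distrib_left by (intro sum.cong) (simp_all add: mult_ac)
  ultimately show ?thesis by simp
qed

text \<open>The polynomial is paired with its own restriction to the circle, which is a
  trigonometric polynomial with coefficients \<open>c k * r ^ k\<close>.\<close>

lemma circle_parseval:
  assumes "0 < r" "r < 1"
  shows "((\<lambda>t. (cmod (\<Sum>k<K. c k * (of_real r * cis (2*pi*t)) ^ k))\<^sup>2)
            has_integral (\<Sum>k<K. (cmod (c k) * r ^ k)\<^sup>2)) {0..1}"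
proof -
  have "((\<lambda>t. Re ((\<Sum>k<K. c k * (of_real r * cis (2*pi*t)) ^ k) *
            cnj (\<Sum>k<K. (c k * of_real r ^ k) * cis (2*pi*t) ^ k)))
          has_integral Re (\<Sum>k<K. cnj (c k * of_real r ^ k) *
            (taylor_coeff (\<lambda>z. \<Sum>k<K. c k * z ^ k) k * of_real r ^ k))) {0..1}"
    by (rule has_integral_linear[OF circle_pairing[OF taylor_coeff_polynomial(1) assms]
          bounded_linear_Re, unfolded o_def])
  moreover have "(\<Sum>k<K. (c k * of_real r ^ k) * cis (2*pi*t) ^ k)
      = (\<Sum>k<K. c k * (of_real r * cis (2*pi*t)) ^ k)" for t
    by (simp add: power_mult_distrib mult.assoc)
  moreover have "Re (\<Sum>k<K. cnj (c k * of_real r ^ k) *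
        (taylor_coeff (\<lambda>z. \<Sum>k<K. c k * z ^ k) k * of_real r ^ k)) = (\<Sum>k<K. (cmod (c k) * r ^ k)\<^sup>2)"
    unfolding Re_sum
  proof (intro sum.cong refl)
    fix k assume "k \<in> {..<K}"
    then have "Re (cnj (c k * of_real r ^ k) * (taylor_coeff (\<lambda>z. \<Sum>k<K. c k * z ^ k) k * of_real r ^ k))
        = Re (c k * of_real r ^ k * cnj (c k * of_real r ^ k))"
      by (simp add: taylor_coeff_polynomial mult_ac)
    also have "\<dots> = (cmod (c k) * r ^ k)\<^sup>2"
      using assms unfolding complex_norm_square[symmetric] by (simp add: norm_mult norm_power)
    finally show "Re (cnj (c k * of_real r ^ k) *
        (taylor_coeff (\<lambda>z. \<Sum>k<K. c k * z ^ k) k * of_real r ^ k)) = (cmod (c k) * r ^ k)\<^sup>2" .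
  qed
  ultimately show ?thesis by (simp only: complex_norm_square[symmetric] Re_complex_of_real)
qed

text \<open>
  The first \<open>K\<close> coefficients of \<open>\<phi>f\<close> depend only on the first \<open>K\<close> of \<open>f\<close>, so it suffices to
  compare mean squares of \<open>\<phi>p\<close> and \<open>p\<close> on circles for polynomials \<open>p\<close>.
\<close>

lemma multiplier_bound:
  assumes hol: "\<phi> holomorphic_on unit_disk" and C: "\<And>z. z \<in> unit_disk \<Longrightarrow> cmod (\<phi> z) \<le> C"
  shows "(\<Sum>k<K. (cmod (convol (taylor_coeff \<phi>) c k))\<^sup>2) \<le> C\<^sup>2 * (\<Sum>k<K. (cmod (c k))\<^sup>2)"
proof -
  define p where "p = (\<lambda>z. \<Sum>k<K. c k * z ^ k)"
  define b where "b = convol (taylor_coeff \<phi>) c"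
  define q where "q = (\<lambda>z. \<Sum>k<K. b k * z ^ k)"
  have holp: "p holomorphic_on unit_disk" unfolding p_def by (rule taylor_coeff_polynomial)
  have coeff: "taylor_coeff (\<lambda>z. \<phi> z * p z) k = b k" if "k < K" for k
    unfolding taylor_coeff_mult[OF hol holp] b_def convol_def
    by (intro sum.cong refl) (use that in \<open>simp add: p_def taylor_coeff_polynomial\<close>)
  have bound: "(\<Sum>k<K. (cmod (b k) * r ^ k)\<^sup>2) \<le> C\<^sup>2 * (\<Sum>k<K. (cmod (c k))\<^sup>2)"
    if r: "0 < r" "r < 1" for r
  proof -
    define S where "S = (\<Sum>k<K. (cmod (b k) * r ^ k)\<^sup>2)"
    define w where "w = (\<lambda>t. complex_of_real r * cis (2*pi*t))"
    \<comment> \<open>The product \<phi>p need not be a polynomial, so it is paired with its Taylor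
      polynomial \<open>q\<close>. The pairing equals \<open>S\<close>, which by
      \<open>circle_parseval\<close> is also the mean square of \<open>q\<close>.\<close>
    have "((\<lambda>t. \<phi> (w t) * p (w t) * cnj (\<Sum>k<K. (b k * of_real r ^ k) * cis (2*pi*t) ^ k))
        has_integral (\<Sum>k<K. cnj (b k * of_real r ^ k) *
          (taylor_coeff (\<lambda>z. \<phi> z * p z) k * of_real r ^ k))) {0..1}"
      unfolding w_def using r hol holp by (intro circle_pairing holomorphic_intros)
    also have "(\<lambda>t. \<Sum>k<K. (b k * of_real r ^ k) * cis (2*pi*t) ^ k) = (\<lambda>t. q (w t))"
      by (simp add: q_def w_def power_mult_distrib mult.assoc)
    also have "(\<Sum>k<K. cnj (b k * of_real r ^ k) * (taylor_coeff (\<lambda>z. \<phi> z * p z) k * of_real r ^ k))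
        = of_real S"
      unfolding S_def of_real_sum
    proof (intro sum.cong refl)
      fix k assume "k \<in> {..<K}"
      then have "cnj (b k * of_real r ^ k) * (taylor_coeff (\<lambda>z. \<phi> z * p z) k * of_real r ^ k)
          = (b k * of_real r ^ k) * cnj (b k * of_real r ^ k)"
        by (simp add: coeff mult_ac)
      also have "\<dots> = of_real ((cmod (b k) * r ^ k)\<^sup>2)"
        using r unfolding complex_norm_square[symmetric] by (simp add: norm_mult norm_power)
      finally show "cnj (b k * of_real r ^ k) * (taylor_coeff (\<lambda>z. \<phi> z * p z) k * of_real r ^ k)
          = of_real ((cmod (b k) * r ^ k)\<^sup>2)" .
    qed
    finally have "((\<lambda>t. \<phi> (w t) * p (w t) * cnj (q (w t))) has_integral of_real S) {0..1}"
      by simp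
    from has_integral_linear[OF this bounded_linear_Re, unfolded o_def Re_complex_of_real]
    have "((\<lambda>t. Re (\<phi> (w t) * p (w t) * cnj (q (w t)))) has_integral S) {0..1}" .
    from has_integral_diff[OF has_integral_mult_right[OF this, of 2] circle_parseval[OF r, of b K]]
    have I: "((\<lambda>t. 2 * Re (\<phi> (w t) * p (w t) * cnj (q (w t))) - (cmod (q (w t)))\<^sup>2)
        has_integral 2 * S - S) {0..1}"
      by (simp add: q_def w_def S_def)
    have J: "((\<lambda>t. C\<^sup>2 * (cmod (p (w t)))\<^sup>2) has_integral C\<^sup>2 * (\<Sum>k<K. (cmod (c k) * r ^ k)\<^sup>2)) {0..1}"
      unfolding p_def w_def by (intro has_integral_mult_right circle_parseval r)
    \<comment> \<open>Expanding |u - v|^2 \<ge> 0 with u = \<phi>p and v = q. After integration the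
      left side becomes 2S - S, so that only polynomials need to have their mean squares
      computed.\<close>
    have "2 * Re (\<phi> (w t) * p (w t) * cnj (q (w t))) - (cmod (q (w t)))\<^sup>2 \<le> C\<^sup>2 * (cmod (p (w t)))\<^sup>2" for t
    proof -
      have "w t \<in> unit_disk" unfolding w_def by (rule circle_in_disk[OF r])
      then have "(cmod (\<phi> (w t) * p (w t)))\<^sup>2 \<le> C\<^sup>2 * (cmod (p (w t)))\<^sup>2"
        using C[of "w t"] by (simp add: norm_mult power_mult_distrib mult_right_mono power_mono)
      moreover have "0 \<le> (cmod (u - v))\<^sup>2 \<Longrightarrow> 2 * Re (u * cnj v) - (cmod v)\<^sup>2 \<le> (cmod u)\<^sup>2" for u v
        by (simp add: cmod_power2 power2_diff)
      ultimately show ?thesis by (smt (verit) zero_le_power2)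
    qed
    then have "2 * S - S \<le> C\<^sup>2 * (\<Sum>k<K. (cmod (c k) * r ^ k)\<^sup>2)"
      by (intro has_integral_le[OF I J])
    also have "\<dots> \<le> C\<^sup>2 * (\<Sum>k<K. (cmod (c k))\<^sup>2)"
      using r by (intro mult_left_mono sum_mono power_mono mult_right_le_one_le power_le_one) auto
    finally show ?thesis by (simp add: S_def)
  qed
  \<comment> \<open>Both sums are finite, so letting \<open>r\<close> tend to 1 from the left
    removes the radius from the bound.\<close>
  have "((\<lambda>r. \<Sum>k<K. (cmod (b k) * r ^ k)\<^sup>2) \<longlongrightarrow> (\<Sum>k<K. (cmod (b k) * 1 ^ k)\<^sup>2)) (at_left (1::real))"
    by (intro tendsto_intros)
  moreover have "eventually (\<lambda>r. (\<Sum>k<K. (cmod (b k) * r ^ k)\<^sup>2) \<le> C\<^sup>2 * (\<Sum>k<K. (cmod (c k))\<^sup>2)) (at_left 1)"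
    by (rule eventually_mono[OF eventually_at_left_real[of 0 1]]) (use bound in auto)
  ultimately show ?thesis unfolding b_def[symmetric]
    using tendsto_upperbound[of _ _ "at_left (1::real)"] by fastforce
qed

section \<open>Adjoints of bounded coefficient matrices\<close>

text \<open>The conjugate transpose of the matrix of \<open>convol a\<close>. The index is shifted
  by \<open>i\<close> so that the zero entries left of the diagonal do not appear.\<close>

definition adj_seq :: "(nat \<Rightarrow> complex) \<Rightarrow> (nat \<Rightarrow> complex) \<Rightarrow> nat \<Rightarrow> complex" where
  "adj_seq a g i = (\<Sum>k. cnj (a k) * g (k + i))"

definition truncate :: "nat \<Rightarrow> (nat \<Rightarrow> complex) \<Rightarrow> nat \<Rightarrow> complex" where
  "truncate J c k = (if k < J then c k else 0)"

lemma truncate_ell2: "ell2 (truncate J c)"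
  by (rule ell2_finite_support[of J]) (simp add: truncate_def)

lemma truncate_norm_sums: "(\<lambda>k. (cmod (truncate J c k))\<^sup>2) sums (\<Sum>k<J. (cmod (c k))\<^sup>2)"
proof -
  have "(\<lambda>k. (cmod (truncate J c k))\<^sup>2) sums (\<Sum>k<J. (cmod (truncate J c k))\<^sup>2)"
    by (rule sums_finite) (auto simp: truncate_def)
  then show ?thesis by (simp add: truncate_def)
qed

text \<open>At each index the truncation is either \<open>c k\<close> or 0, so the squared moduli
  subtract exactly and the sum is the tail of a convergent series.\<close>

lemma truncate_tendsto:
  assumes "ell2 c"
  shows "(\<lambda>J. \<Sum>k. (cmod (c k - truncate J c k))\<^sup>2) \<longlonglongrightarrow> 0"
proof -
  have sc: "summable (\<lambda>k. (cmod (c k))\<^sup>2)" using assms by (simp add: ell2_def)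
  have "(\<lambda>k. (cmod (c k))\<^sup>2 - (cmod (truncate J c k))\<^sup>2) sums
      ((\<Sum>k. (cmod (c k))\<^sup>2) - (\<Sum>k<J. (cmod (c k))\<^sup>2))" for J
    by (intro sums_diff truncate_norm_sums summable_sums sc)
  moreover have "(cmod (c k))\<^sup>2 - (cmod (truncate J c k))\<^sup>2 = (cmod (c k - truncate J c k))\<^sup>2" for J k
    by (simp add: truncate_def)
  ultimately have "(\<Sum>k. (cmod (c k - truncate J c k))\<^sup>2)
      = (\<Sum>k. (cmod (c k))\<^sup>2) - (\<Sum>k<J. (cmod (c k))\<^sup>2)" for J
    by (simp add: sums_iff)
  moreover have "(\<lambda>J. (\<Sum>k. (cmod (c k))\<^sup>2) - (\<Sum>k<J. (cmod (c k))\<^sup>2)) \<longlonglongrightarrow> (\<Sum>k. (cmod (c k))\<^sup>2) - (\<Sum>k. (cmod (c k))\<^sup>2)"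
    by (intro tendsto_diff tendsto_const summable_LIMSEQ sc)
  ultimately show "(\<lambda>J. \<Sum>k. (cmod (c k - truncate J c k))\<^sup>2) \<longlonglongrightarrow> 0" by simp
qed

lemma convol_diff: "convol a (\<lambda>k. c k - d k) k = convol a c k - convol a d k"
  by (simp add: convol_def right_diff_distrib sum_subtractf)

text \<open>A sum of columns over a range independent of \<open>k\<close>, ready to be exchanged
  with a series in \<open>k\<close>.\<close>

lemma convol_truncate:
  "convol a (truncate J c) k = (\<Sum>i<J. c i * (if i \<le> k then a (k - i) else 0))"
proof -
  have "convol a (truncate J c) k = (\<Sum>i=0..k. a (k - i) * truncate J c i)"
    unfolding convol_def by (rule sum.reindex_bij_witness[of _ "\<lambda>i. k - i" "\<lambda>i. k - i"]) auto
  also have "\<dots> = (\<Sum>i\<in>{0..k} \<inter> {..<J}. c i * a (k - i))"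
    unfolding truncate_def by (subst sum.inter_restrict) (auto intro!: sum.cong)
  also have "\<dots> = (\<Sum>i<J. c i * (if i \<le> k then a (k - i) else 0))"
    by (subst Int_commute, subst sum.inter_restrict) (auto intro!: sum.cong)
  finally show ?thesis .
qed

text \<open>The bound is imposed on finite sections. The matrix is lower triangular, so the first
  \<open>K\<close> outputs involve only the first \<open>K\<close> inputs and \<open>c\<close> may
  be any sequence; the bound on square-summable sequences follows in the limit.\<close>

locale bounded_multiplier =
  fixes a :: "nat \<Rightarrow> complex" and C :: real
  assumes bound: "\<And>c K. (\<Sum>k<K. (cmod (convol a c k))\<^sup>2) \<le> C\<^sup>2 * (\<Sum>k<K. (cmod (c k))\<^sup>2)"
begin

lemma convol_ell2:
  assumes "ell2 c"
  shows "ell2 (convol a c)" "(\<Sum>k. (cmod (convol a c k))\<^sup>2) \<le> C\<^sup>2 * (\<Sum>k. (cmod (c k))\<^sup>2)"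
proof -
  have "(\<Sum>k<K. (cmod (convol a c k))\<^sup>2) \<le> C\<^sup>2 * (\<Sum>k. (cmod (c k))\<^sup>2)" for K
    by (rule order_trans[OF bound]) (intro mult_left_mono ell2_sum_le assms, simp)
  from ell2_bounded_sums[OF this] show "ell2 (convol a c)"
    "(\<Sum>k. (cmod (convol a c k))\<^sup>2) \<le> C\<^sup>2 * (\<Sum>k. (cmod (c k))\<^sup>2)" by auto
qed

text \<open>\<open>a\<close> is the first column of the matrix, the image of the first unit
  vector.\<close>

lemma symbol_ell2: "ell2 a"
proof -
  define e :: "nat \<Rightarrow> complex" where "e = (\<lambda>k. if k = 0 then 1 else 0)"
  have "convol a e = a"
  proof
    fix k
    have "convol a e k = (\<Sum>i=0..k. if i = k then a i else 0)"
      unfolding convol_def e_def by (intro sum.cong) auto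
    then show "convol a e k = a k" by simp
  qed
  moreover have "ell2 e" by (rule ell2_finite_support[of 1]) (simp add: e_def)
  ultimately show ?thesis using convol_ell2 by metis
qed

text \<open>For finitely many columns the sum over \<open>i\<close> may be exchanged with the series
  over \<open>k\<close>. Column \<open>i\<close> paired with \<open>g\<close> is the conjugate of
  \<open>adj_seq a g i\<close>.\<close>

lemma truncated_pairing:
  assumes g: "ell2 g"
  shows "(\<Sum>k. convol a (truncate J c) k * cnj (g k)) = (\<Sum>i<J. c i * cnj (adj_seq a g i))"
proof -
  have s: "(\<lambda>k. (if i \<le> k then a (k - i) else 0) * cnj (g k)) sums cnj (adj_seq a g i)" for i
  proof -
    have "(\<lambda>k. a k * cnj (g (k + i))) sums (\<Sum>k. a k * cnj (g (k + i)))"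
      by (rule summable_sums[OF ell2_summable_mult_cnj[OF symbol_ell2 ell2_shift[OF g]]])
    moreover from this have "(\<lambda>k. cnj (a k * cnj (g (k + i)))) sums cnj (\<Sum>k. a k * cnj (g (k + i)))"
      by (simp only: sums_cnj)
    then have "adj_seq a g i = cnj (\<Sum>k. a k * cnj (g (k + i)))"
      by (simp add: adj_seq_def sums_iff)
    ultimately have "(\<lambda>k. a k * cnj (g (k + i))) sums cnj (adj_seq a g i)" by simp
    \<comment> \<open>Column \<open>i\<close> vanishes above the diagonal, so its first
      \<open>i\<close> terms contribute nothing and the shift preserves the sum.\<close>
    then show ?thesis
      using sums_iff_shift[of "\<lambda>k. (if i \<le> k then a (k - i) else 0) * cnj (g k)" i "cnj (adj_seq a g i)"]
      by simp
  qed
  have "(\<lambda>k. \<Sum>i<J. c i * ((if i \<le> k then a (k - i) else 0) * cnj (g k))) sums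
      (\<Sum>i<J. c i * cnj (adj_seq a g i))"
    by (intro sums_sum sums_mult s)
  moreover have "(\<Sum>i<J. c i * ((if i \<le> k then a (k - i) else 0) * cnj (g k)))
      = convol a (truncate J c) k * cnj (g k)" for k
    unfolding convol_truncate sum_distrib_right by (simp add: mult.assoc)
  ultimately show ?thesis by (simp add: sums_iff)
qed

lemma pairing_bound:
  assumes "ell2 c" "ell2 g"
  shows "(cmod (\<Sum>k. convol a c k * cnj (g k)))\<^sup>2 \<le> C\<^sup>2 * (\<Sum>k. (cmod (c k))\<^sup>2) * (\<Sum>k. (cmod (g k))\<^sup>2)"
proof -
  have "(cmod (\<Sum>k. convol a c k * cnj (g k)))\<^sup>2 \<le> (\<Sum>k. (cmod (convol a c k))\<^sup>2) * (\<Sum>k. (cmod (g k))\<^sup>2)"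
    by (intro ell2_Cauchy_Schwarz convol_ell2 assms)
  also have "\<dots> \<le> C\<^sup>2 * (\<Sum>k. (cmod (c k))\<^sup>2) * (\<Sum>k. (cmod (g k))\<^sup>2)"
    using assms(2) by (intro mult_right_mono convol_ell2 assms suminf_nonneg) (auto simp: ell2_def)
  finally show ?thesis .
qed

text \<open>Testing the truncated pairing against the truncation of the adjoint sequence itself.\<close>

lemma adj_seq_ell2:
  assumes g: "ell2 g"
  shows "ell2 (adj_seq a g)" "(\<Sum>k. (cmod (adj_seq a g k))\<^sup>2) \<le> C\<^sup>2 * (\<Sum>k. (cmod (g k))\<^sup>2)"
proof -
  define h where "h = adj_seq a g"
  have "(\<Sum>k<J. (cmod (h k))\<^sup>2) \<le> C\<^sup>2 * (\<Sum>k. (cmod (g k))\<^sup>2)" for J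
  proof -
    define S where "S = (\<Sum>k<J. (cmod (h k))\<^sup>2)"
    have T: "(\<Sum>k. (cmod (truncate J h k))\<^sup>2) = S"
      unfolding S_def by (rule sums_unique[OF truncate_norm_sums, symmetric])
    have "(\<Sum>k. convol a (truncate J h) k * cnj (g k)) = (\<Sum>i<J. h i * cnj (h i))"
      unfolding h_def by (rule truncated_pairing[OF g])
    also have "\<dots> = of_real S"
      unfolding S_def of_real_sum by (simp only: complex_norm_square)
    finally have "S\<^sup>2 \<le> C\<^sup>2 * S * (\<Sum>k. (cmod (g k))\<^sup>2)"
      using pairing_bound[OF truncate_ell2[of J h] g] unfolding T by simp
    moreover have "0 \<le> S" unfolding S_def by (intro sum_nonneg) auto
    moreover have "0 \<le> C\<^sup>2 * (\<Sum>k. (cmod (g k))\<^sup>2)"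
      using g by (intro mult_nonneg_nonneg suminf_nonneg) (auto simp: ell2_def)
    \<comment> \<open>The inequality has \<open>S\<close> squared on the left and \<open>S\<close>
      once on the right, so division by \<open>S\<close> settles every case but
      \<open>S = 0\<close>.\<close>
    ultimately have "S \<le> C\<^sup>2 * (\<Sum>k. (cmod (g k))\<^sup>2)"
      by (cases "S = 0") (auto simp: power2_eq_square mult.assoc mult.left_commute)
    then show ?thesis by (simp add: S_def)
  qed
  from ell2_bounded_sums[OF this] show "ell2 (adj_seq a g)"
    "(\<Sum>k. (cmod (adj_seq a g k))\<^sup>2) \<le> C\<^sup>2 * (\<Sum>k. (cmod (g k))\<^sup>2)" by (auto simp: h_def)
qed

text \<open>The values at truncations of \<open>c\<close> are the partial sums of the right side by
  \<open>truncated_pairing\<close>. They also tend to the left side, because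
  \<open>pairing_bound\<close> makes it continuous in \<open>c\<close>.\<close>

lemma adj_seq_pairing:
  assumes c: "ell2 c" and g: "ell2 g"
  shows "(\<Sum>k. convol a c k * cnj (g k)) = (\<Sum>k. c k * cnj (adj_seq a g k))"
proof -
  define B where "B = (\<lambda>c. \<Sum>k. convol a c k * cnj (g k))"
  define G where "G = (\<Sum>k. (cmod (g k))\<^sup>2)"
  have diff: "B c - B (truncate J c) = B (\<lambda>k. c k - truncate J c k)" for J
    unfolding B_def convol_diff left_diff_distrib
    by (intro suminf_diff ell2_summable_mult_cnj convol_ell2 truncate_ell2 c g)
  have le: "(cmod (B c - B (truncate J c)))\<^sup>2 \<le> C\<^sup>2 * (\<Sum>k. (cmod (c k - truncate J c k))\<^sup>2) * G" for J
    unfolding diff unfolding B_def G_def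
    by (intro pairing_bound ell2_diff truncate_ell2 c g)
  have lim: "(\<lambda>J. C\<^sup>2 * (\<Sum>k. (cmod (c k - truncate J c k))\<^sup>2) * G) \<longlonglongrightarrow> 0"
    by (intro tendsto_mult_left_zero tendsto_mult_right_zero truncate_tendsto c)
  have "(\<lambda>J. (cmod (B c - B (truncate J c)))\<^sup>2) \<longlonglongrightarrow> 0"
    by (rule tendsto_sandwich[OF always_eventually always_eventually tendsto_const lim])
       (use le in simp_all)
  from tendsto_real_sqrt[OF this] have "(\<lambda>J. cmod (B c - B (truncate J c))) \<longlonglongrightarrow> 0"
    by simp
  then have "(\<lambda>J. B c - B (truncate J c)) \<longlonglongrightarrow> 0" by (rule tendsto_norm_zero_cancel)
  then have "(\<lambda>J. B c - (B c - B (truncate J c))) \<longlonglongrightarrow> B c - 0" by (intro tendsto_intros)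
  then have "(\<lambda>J. \<Sum>k<J. c k * cnj (adj_seq a g k)) \<longlonglongrightarrow> B c"
    by (simp add: B_def truncated_pairing[OF g])
  moreover have "(\<lambda>J. \<Sum>k<J. c k * cnj (adj_seq a g k)) \<longlonglongrightarrow> (\<Sum>k. c k * cnj (adj_seq a g k))"
    by (intro summable_LIMSEQ ell2_summable_mult_cnj adj_seq_ell2 c g)
  ultimately show ?thesis unfolding B_def by (rule LIMSEQ_unique)
qed

end

lemma Hinf_bounded_multiplier:
  assumes "\<phi> \<in> Hinf"
  obtains C where "bounded_multiplier (taylor_coeff \<phi>) C"
proof -
  from assms obtain C where "\<And>z. z \<in> unit_disk \<Longrightarrow> cmod (\<phi> z) \<le> C"
    unfolding Hinf_def bounded_iff by blast
  then have "bounded_multiplier (taylor_coeff \<phi>) C"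
    using assms by unfold_locales (rule multiplier_bound, auto simp: Hinf_def)
  then show ?thesis by (rule that)
qed

section \<open>Hardy spaces\<close>

lemma H2D:
  assumes "f \<in> H2"
  shows "f holomorphic_on unit_disk" "\<And>z. z \<notin> unit_disk \<Longrightarrow> f z = 0" "ell2 (taylor_coeff f)"
  using assms by (auto simp: H2_def ell2_def)

text \<open>These are the Taylor coefficients of the Szego kernel at \<open>z\<close>: pairing a
  sequence with them evaluates its power series at \<open>z\<close>.\<close>

lemma ell2_geometric: "z \<in> unit_disk \<Longrightarrow> ell2 (\<lambda>k. cnj z ^ k)"
  unfolding ell2_def by (simp add: norm_power power_mult[symmetric] mult.commute[of _ 2])
     (simp add: power_mult summable_geometric power_less_one_iff abs_square_less_1)

text \<open>Inverse of the map from \<open>H2\<close> to square-summable sequences; the value 0 off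
  the disk is what \<open>H2\<close> demands.\<close>

definition of_coeffs :: "(nat \<Rightarrow> complex) \<Rightarrow> complex \<Rightarrow> complex" where
  "of_coeffs c z = (if z \<in> unit_disk then \<Sum>k. c k * z ^ k else 0)"

lemma of_coeffs:
  assumes "ell2 c"
  shows "of_coeffs c \<in> H2" "taylor_coeff (of_coeffs c) = c"
proof -
  have sums: "(\<lambda>k. c k * z ^ k) sums of_coeffs c z" if "z \<in> unit_disk" for z
    using summable_sums[OF ell2_summable_mult_cnj[OF assms ell2_geometric[OF that]]] that
    by (simp add: of_coeffs_def)
  have p: "of_coeffs c holomorphic_on unit_disk" "taylor_coeff (of_coeffs c) = c"
    by (rule power_series_disk(1), erule sums) (rule power_series_disk(2), erule sums)
  then show "taylor_coeff (of_coeffs c) = c" by blast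
  show "of_coeffs c \<in> H2"
    unfolding H2_def mem_Collect_eq p(2) using p(1) assms by (simp add: ell2_def of_coeffs_def)
qed

lemma H2_eqI:
  assumes "f \<in> H2" "g \<in> H2" "\<And>k. taylor_coeff f k = taylor_coeff g k"
  shows "f = g"
proof
  fix z show "f z = g z"
  proof (cases "z \<in> unit_disk")
    case True
    show ?thesis
      using taylor_sums[OF H2D(1)[OF assms(1)] True] taylor_sums[OF H2D(1)[OF assms(2)] True]
      unfolding assms(3) by (rule sums_unique2)
  next
    case False
    then show ?thesis using H2D(2) assms(1,2) by metis
  qed
qed

lemma taylor_coeff_zero_fun: "taylor_coeff 0 k = 0"
  using taylor_coeff_zero by (simp add: zero_fun_def)

lemma H2_zero: "0 \<in> H2"
  using holomorphic_on_const[of 0 unit_disk] unfolding H2_def mem_Collect_eq taylor_coeff_zero_fun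
  by (simp add: zero_fun_def)

lemma H2_cscale:
  assumes "f \<in> H2"
  shows "cscale c f \<in> H2" "taylor_coeff (cscale c f) k = c * taylor_coeff f k"
proof -
  have t: "taylor_coeff (cscale c f) k = c * taylor_coeff f k" for k
    unfolding cscale_def by (rule taylor_coeff_cmult[OF H2D(1)[OF assms]])
  then show "taylor_coeff (cscale c f) k = c * taylor_coeff f k" .
  show "cscale c f \<in> H2"
    using H2D[OF assms] ell2_cmult[OF H2D(3)[OF assms], of c]
    unfolding H2_def mem_Collect_eq t ell2_def
    by (auto simp: cscale_def intro!: holomorphic_intros)
qed

lemma H2_add:
  assumes "f \<in> H2" "g \<in> H2"
  shows "f + g \<in> H2" "taylor_coeff (f + g) k = taylor_coeff f k + taylor_coeff g k"
proof -
  have t: "taylor_coeff (f + g) k = taylor_coeff f k + taylor_coeff g k" for k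
    unfolding plus_fun_def by (intro taylor_coeff_add H2D assms)
  then show "taylor_coeff (f + g) k = taylor_coeff f k + taylor_coeff g k" .
  show "f + g \<in> H2"
    using H2D[OF assms(1)] H2D[OF assms(2)] ell2_add[OF H2D(3)[OF assms(1)] H2D(3)[OF assms(2)]]
    unfolding H2_def mem_Collect_eq t ell2_def
    by (auto simp: plus_fun_def intro!: holomorphic_intros)
qed

lemma H2_diff:
  assumes "f \<in> H2" "g \<in> H2"
  shows "f - g \<in> H2" "taylor_coeff (f - g) k = taylor_coeff f k - taylor_coeff g k"
  using H2_add[OF assms(1) H2_cscale(1)[OF assms(2), of "- 1"]] H2_cscale(2)[OF assms(2), of "- 1"]
  by simp_all

lemma H2_inner_self:
  assumes "f \<in> H2"
  shows "H2_inner f f = of_real ((ip_norm H2_inner f)\<^sup>2)"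
    "(ip_norm H2_inner f)\<^sup>2 = (\<Sum>k. (cmod (taylor_coeff f k))\<^sup>2)"
proof -
  have s: "summable (\<lambda>k. (cmod (taylor_coeff f k))\<^sup>2)" using H2D(3)[OF assms] by (simp add: ell2_def)
  have "H2_inner f f = (\<Sum>k. of_real ((cmod (taylor_coeff f k))\<^sup>2))"
    unfolding H2_inner_def complex_norm_square ..
  also have "\<dots> = of_real (\<Sum>k. (cmod (taylor_coeff f k))\<^sup>2)"
    by (rule suminf_of_real[OF s, symmetric])
  finally have e: "H2_inner f f = of_real (\<Sum>k. (cmod (taylor_coeff f k))\<^sup>2)" .
  then show "(ip_norm H2_inner f)\<^sup>2 = (\<Sum>k. (cmod (taylor_coeff f k))\<^sup>2)"
    using suminf_nonneg[OF s] by (simp add: ip_norm_def)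
  with e show "H2_inner f f = of_real ((ip_norm H2_inner f)\<^sup>2)" by simp
qed

text \<open>A crude triangle inequality in squared form, used to compare series of squared norms
  over the w-coefficients.\<close>

lemma H2_norm_diff_le:
  assumes "f \<in> H2" "g \<in> H2"
  shows "(ip_norm H2_inner (f - g))\<^sup>2 \<le> 2 * (ip_norm H2_inner f)\<^sup>2 + 2 * (ip_norm H2_inner g)\<^sup>2"
proof -
  have s: "summable (\<lambda>k. (cmod (taylor_coeff h k))\<^sup>2)" if "h \<in> H2" for h
    using H2D(3)[OF that] by (simp add: ell2_def)
  have "(\<Sum>k. (cmod (taylor_coeff (f - g) k))\<^sup>2)
      \<le> (\<Sum>k. 2 * (cmod (taylor_coeff f k))\<^sup>2 + 2 * (cmod (taylor_coeff g k))\<^sup>2)"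
  proof (rule suminf_le)
    show "(cmod (taylor_coeff (f - g) k))\<^sup>2 \<le> 2 * (cmod (taylor_coeff f k))\<^sup>2 + 2 * (cmod (taylor_coeff g k))\<^sup>2" for k
      using norm_add_sq_le[of "taylor_coeff f k" "- taylor_coeff g k"] H2_diff(2)[OF assms] by simp
  qed (intro s summable_add summable_mult assms H2_diff)+
  also have "\<dots> = 2 * (\<Sum>k. (cmod (taylor_coeff f k))\<^sup>2) + 2 * (\<Sum>k. (cmod (taylor_coeff g k))\<^sup>2)"
    using s assms by (simp add: suminf_add[symmetric] suminf_mult summable_mult)
  finally show ?thesis using assms by (simp add: H2_inner_self H2_diff)
qed

text \<open>Cauchy-Schwarz against the Szego kernel; \<open>B\<close> depends on \<open>z\<close>
  alone.\<close>

lemma H2_point_evaluation: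
  assumes "z \<in> unit_disk"
  obtains B where "\<And>f. f \<in> H2 \<Longrightarrow> (cmod (f z))\<^sup>2 \<le> (ip_norm H2_inner f)\<^sup>2 * B"
proof
  fix f assume f: "f \<in> H2"
  have "f z = (\<Sum>k. taylor_coeff f k * cnj (cnj z ^ k))"
    using taylor_sums[OF H2D(1)[OF f] assms] by (simp add: sums_iff)
  then show "(cmod (f z))\<^sup>2 \<le> (ip_norm H2_inner f)\<^sup>2 * (\<Sum>k. (cmod (cnj z ^ k))\<^sup>2)"
    using ell2_Cauchy_Schwarz[OF H2D(3)[OF f] ell2_geometric[OF assms]] by (simp only: H2_inner_self(2)[OF f])
qed

text \<open>The monomial z^k reads off the k-th coefficient. It serves as test function for the
  uniqueness of adjoints.\<close>

lemma H2_coordinate: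
  obtains e where "e \<in> H2" "\<And>h. H2_inner e h = cnj (taylor_coeff h k)"
proof
  define c :: "nat \<Rightarrow> complex" where "c = (\<lambda>i. if i = k then 1 else 0)"
  have c: "ell2 c" by (rule ell2_finite_support[of "Suc k"]) (simp add: c_def)
  show "of_coeffs c \<in> H2" by (rule of_coeffs[OF c])
  fix h
  have "(\<lambda>i. c i * cnj (taylor_coeff h i)) sums (\<Sum>i\<in>{k}. c i * cnj (taylor_coeff h i))"
    by (rule sums_finite) (auto simp: c_def)
  then show "H2_inner (of_coeffs c) h = cnj (taylor_coeff h k)"
    unfolding H2_inner_def of_coeffs(2)[OF c] by (simp add: sums_iff) (simp add: c_def)
qed

text \<open>The function with coefficients \<open>adj_seq\<close> satisfies the adjoint identity,
  and testing with monomials shows that it is the only one, so the definite description denotes it.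
  \<open>C\<close> is independent of \<open>g\<close>, so one bound will serve all w-coefficients on
  the bidisk.\<close>

lemma toeplitz_disk_adj:
  assumes \<phi>: "\<phi> \<in> Hinf" and C: "bounded_multiplier (taylor_coeff \<phi>) C" and g: "g \<in> H2"
  shows "toeplitz_disk_adj \<phi> g \<in> H2"
    "\<And>f. f \<in> H2 \<Longrightarrow> H2_inner (toeplitz_disk \<phi> f) g = H2_inner f (toeplitz_disk_adj \<phi> g)"
    "(ip_norm H2_inner (toeplitz_disk_adj \<phi> g))\<^sup>2 \<le> C\<^sup>2 * (ip_norm H2_inner g)\<^sup>2"
proof -
  interpret bounded_multiplier "taylor_coeff \<phi>" C by (rule C)
  define h where "h = of_coeffs (adj_seq (taylor_coeff \<phi>) (taylor_coeff g))"
  note ad = adj_seq_ell2[OF H2D(3)[OF g]]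
  have h: "h \<in> H2" unfolding h_def by (rule of_coeffs[OF ad(1)])
  have th: "taylor_coeff h = adj_seq (taylor_coeff \<phi>) (taylor_coeff g)"
    unfolding h_def by (rule of_coeffs[OF ad(1)])
  have inner: "H2_inner (toeplitz_disk \<phi> f) g = H2_inner f h" if f: "f \<in> H2" for f
  proof -
    have "taylor_coeff (toeplitz_disk \<phi> f) k = convol (taylor_coeff \<phi>) (taylor_coeff f) k" for k
      unfolding toeplitz_disk_def using \<phi> H2D(1)[OF f] by (intro taylor_coeff_mult) (auto simp: Hinf_def)
    then show ?thesis
      unfolding H2_inner_def th using adj_seq_pairing[OF H2D(3)[OF f] H2D(3)[OF g]] by simp
  qed
  have "toeplitz_disk_adj \<phi> g = h"
    unfolding toeplitz_disk_adj_def adjoint_on_def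
  proof (rule the_equality)
    show "h \<in> H2 \<and> (\<forall>f\<in>H2. H2_inner (toeplitz_disk \<phi> f) g = H2_inner f h)"
      using h inner by blast
    fix h' assume h': "h' \<in> H2 \<and> (\<forall>f\<in>H2. H2_inner (toeplitz_disk \<phi> f) g = H2_inner f h')"
    show "h' = h"
    proof (rule H2_eqI)
      fix k
      obtain e where "e \<in> H2" "\<And>h. H2_inner e h = cnj (taylor_coeff h k)" using H2_coordinate[of k] by metis
      then show "taylor_coeff h' k = taylor_coeff h k" using h' inner by (metis complex_cnj_cancel_iff)
    qed (use h h' in auto)
  qed
  then show "toeplitz_disk_adj \<phi> g \<in> H2"
    "\<And>f. f \<in> H2 \<Longrightarrow> H2_inner (toeplitz_disk \<phi> f) g = H2_inner f (toeplitz_disk_adj \<phi> g)"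
    "(ip_norm H2_inner (toeplitz_disk_adj \<phi> g))\<^sup>2 \<le> C\<^sup>2 * (ip_norm H2_inner g)\<^sup>2"
    using h inner ad(2) g by (simp_all add: H2_inner_self(2) th)
qed

section \<open>The Hardy space over the bidisk, by w-coefficients\<close>

lemma H2_bidiskD:
  assumes "g \<in> H2_bidisk"
  shows "\<And>p. p \<notin> unit_disk \<times> unit_disk \<Longrightarrow> g p = 0" "\<And>n. w_coeff g n \<in> H2"
    "summable (\<lambda>n. (ip_norm H2_inner (w_coeff g n))\<^sup>2)"
    "\<And>z w. z \<in> unit_disk \<Longrightarrow> w \<in> unit_disk \<Longrightarrow> (\<lambda>n. w_coeff g n z * w ^ n) sums g (z, w)"
  using assms unfolding H2_bidisk_def by blast+

text \<open>In the disk the slice is its power series in w; for other \<open>z\<close> it is zero.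
  Covering every \<open>z\<close> makes the linearity rules for \<open>w_coeff\<close> equalities of
  total functions.\<close>

lemma H2_bidisk_slice_holomorphic:
  assumes "g \<in> H2_bidisk"
  shows "(\<lambda>w. g (z, w)) holomorphic_on unit_disk"
proof (cases "z \<in> unit_disk")
  case True
  show ?thesis by (rule power_series_disk(1)) (rule H2_bidiskD(4)[OF assms True])
next
  case False
  then have "(\<lambda>w. g (z, w)) = (\<lambda>w. 0)" using H2_bidiskD(1)[OF assms] by auto
  then show ?thesis by simp
qed

lemma H2_bidisk_eqI:
  assumes "f \<in> H2_bidisk" "g \<in> H2_bidisk" "\<And>n. w_coeff f n = w_coeff g n"
  shows "f = g"
proof
  fix p show "f p = g p"
  proof (cases "p \<in> unit_disk \<times> unit_disk")
    case True
    then obtain z w where p: "p = (z, w)" "z \<in> unit_disk" "w \<in> unit_disk" by auto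
    show ?thesis
      using H2_bidiskD(4)[OF assms(1) p(2,3)] H2_bidiskD(4)[OF assms(2) p(2,3)]
      unfolding assms(3) p(1) by (rule sums_unique2)
  next
    case False
    then show ?thesis using H2_bidiskD(1) assms by metis
  qed
qed

definition of_w_coeffs :: "(nat \<Rightarrow> complex \<Rightarrow> complex) \<Rightarrow> complex \<times> complex \<Rightarrow> complex" where
  "of_w_coeffs h = (\<lambda>(z, w). if z \<in> unit_disk \<and> w \<in> unit_disk then \<Sum>n. h n z * w ^ n else 0)"

text \<open>Point evaluation at z turns summable squared norms into square-summable values
  \<open>h n z\<close>, so the series in w converges, and uniqueness of its coefficients recovers
  \<open>h n\<close>.\<close>

lemma of_w_coeffs:
  assumes h: "\<And>n. h n \<in> H2" and s: "summable (\<lambda>n. (ip_norm H2_inner (h n))\<^sup>2)"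
  shows "of_w_coeffs h \<in> H2_bidisk" "w_coeff (of_w_coeffs h) n = h n"
proof -
  have sums: "(\<lambda>n. h n z * w ^ n) sums of_w_coeffs h (z, w)"
    if z: "z \<in> unit_disk" and w: "w \<in> unit_disk" for z w
  proof -
    obtain B where B: "\<And>f. f \<in> H2 \<Longrightarrow> (cmod (f z))\<^sup>2 \<le> (ip_norm H2_inner f)\<^sup>2 * B"
      using H2_point_evaluation[OF z] by blast
    have "ell2 (\<lambda>n. h n z)" unfolding ell2_def
      by (rule summable_comparison_test'[OF summable_mult2[OF s, of B]]) (simp add: B h)
    from ell2_summable_mult_cnj[OF this ell2_geometric[OF w]]
    show ?thesis using z w by (simp add: of_w_coeffs_def summable_sums)
  qed
  have w: "w_coeff (of_w_coeffs h) n z = h n z" for n z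
  proof (cases "z \<in> unit_disk")
    case True
    show ?thesis unfolding w_coeff_def by (rule fun_cong[OF power_series_disk(2)]) (rule sums[OF True])
  next
    case False
    then show ?thesis
      using H2D(2)[OF h] by (simp add: w_coeff_def of_w_coeffs_def taylor_coeff_zero)
  qed
  then have w': "w_coeff (of_w_coeffs h) n = h n" for n by blast
  then show "w_coeff (of_w_coeffs h) n = h n" .
  show "of_w_coeffs h \<in> H2_bidisk"
    unfolding H2_bidisk_def mem_Collect_eq w' using h s sums by (auto simp: of_w_coeffs_def)
qed

lemma w_coeff_zero: "w_coeff 0 n = 0"
  by (simp add: w_coeff_def fun_eq_iff taylor_coeff_zero)

lemma w_coeff_add:
  assumes "f \<in> H2_bidisk" "g \<in> H2_bidisk"
  shows "w_coeff (f + g) n = w_coeff f n + w_coeff g n"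
  unfolding w_coeff_def plus_fun_def fun_eq_iff
  by (intro allI taylor_coeff_add H2_bidisk_slice_holomorphic assms)

lemma w_coeff_cscale:
  assumes "f \<in> H2_bidisk"
  shows "w_coeff (cscale c f) n = cscale c (w_coeff f n)"
  unfolding w_coeff_def cscale_def fun_eq_iff
  by (intro allI taylor_coeff_cmult H2_bidisk_slice_holomorphic assms)

lemma w_coeff_diff:
  assumes "f \<in> H2_bidisk" "g \<in> H2_bidisk"
  shows "w_coeff (f - g) n = w_coeff f n - w_coeff g n"
proof -
  have "taylor_coeff (\<lambda>w. f (z, w) + (- 1) * g (z, w)) n
      = taylor_coeff (\<lambda>w. f (z, w)) n + (- 1) * taylor_coeff (\<lambda>w. g (z, w)) n" for z
    using H2_bidisk_slice_holomorphic[OF assms(1), of z] H2_bidisk_slice_holomorphic[OF assms(2), of z]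
    by (simp only: taylor_coeff_add taylor_coeff_cmult holomorphic_on_mult holomorphic_on_const)
  then show ?thesis by (simp add: w_coeff_def fun_eq_iff)
qed

lemma w_coeff_toeplitz:
  assumes "f \<in> H2_bidisk"
  shows "w_coeff (toeplitz_bidisk \<phi> f) n = toeplitz_disk \<phi> (w_coeff f n)"
  unfolding w_coeff_def toeplitz_bidisk_def toeplitz_disk_def fun_eq_iff
  by (auto intro!: taylor_coeff_cmult H2_bidisk_slice_holomorphic assms)

text \<open>The isometry of \<open>H2\<close> onto H_n. It carries statements about P_n(M) to the
  disk and supplies test functions for a single w-coefficient.\<close>

definition embed_w :: "nat \<Rightarrow> (complex \<Rightarrow> complex) \<Rightarrow> complex \<times> complex \<Rightarrow> complex" where
  "embed_w n f = (\<lambda>(z, w). if z \<in> unit_disk \<and> w \<in> unit_disk then f z * w ^ n else 0)"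

lemma proj_w_eq_embed: "proj_w n g = embed_w n (w_coeff g n)"
  by (simp add: proj_w_def embed_w_def)

lemma embed_w:
  assumes "f \<in> H2"
  shows "embed_w n f \<in> H2_bidisk" "w_coeff (embed_w n f) m = (if m = n then f else 0)"
proof -
  define h where "h = (\<lambda>m. if m = n then f else 0)"
  have h: "h m \<in> H2" for m using assms H2_zero by (simp add: h_def)
  have z: "ip_norm H2_inner 0 = 0"
    by (simp add: ip_norm_def H2_inner_def taylor_coeff_zero_fun)
  have s: "summable (\<lambda>m. (ip_norm H2_inner (h m))\<^sup>2)"
    by (rule summable_finite[of "{n}"]) (auto simp: h_def z)
  have "(\<Sum>m. h m z * w ^ m) = f z * w ^ n" for z w
    using sums_finite[of "{n}" "\<lambda>m. h m z * w ^ m"] by (auto simp: h_def sums_iff)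
  then have "embed_w n f = of_w_coeffs h" unfolding embed_w_def of_w_coeffs_def by presburger
  with of_w_coeffs[of h, OF h s] show "embed_w n f \<in> H2_bidisk"
    "w_coeff (embed_w n f) m = (if m = n then f else 0)" by (simp_all add: h_def)
qed

lemma H2_bidisk_inner_embed:
  assumes "f \<in> H2"
  shows "H2_bidisk_inner (embed_w n f) g = H2_inner f (w_coeff g n)"
proof -
  have "(\<lambda>m. H2_inner (w_coeff (embed_w n f) m) (w_coeff g m)) sums
      (\<Sum>m\<in>{n}. H2_inner (w_coeff (embed_w n f) m) (w_coeff g m))"
    by (rule sums_finite) (auto simp: embed_w(2)[OF assms] H2_inner_def taylor_coeff_zero_fun)
  then show ?thesis by (simp add: H2_bidisk_inner_def sums_iff embed_w(2)[OF assms])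
qed

lemma embed_w_diff: "embed_w n f - embed_w n g = embed_w n (f - g)"
  by (auto simp: embed_w_def fun_eq_iff algebra_simps)

lemma ip_norm_embed: "f \<in> H2 \<Longrightarrow> ip_norm H2_bidisk_inner (embed_w n f) = ip_norm H2_inner f"
  by (simp add: ip_norm_def H2_bidisk_inner_embed embed_w)

text \<open>The inner product is a sum over w-coefficients and multiplication by \<phi> acts on
  each, so the coefficientwise adjoint satisfies the defining identity. Testing with z^k w^m gives
  uniqueness.\<close>

lemma toeplitz_bidisk_adj:
  assumes \<phi>: "\<phi> \<in> Hinf" and g: "g \<in> H2_bidisk"
  shows "w_coeff (toeplitz_bidisk_adj \<phi> g) n = toeplitz_disk_adj \<phi> (w_coeff g n)"
proof -
  obtain C where C: "bounded_multiplier (taylor_coeff \<phi>) C"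
    using Hinf_bounded_multiplier[OF \<phi>] .
  note adj = toeplitz_disk_adj[OF \<phi> C H2_bidiskD(2)[OF g]]
  define h where "h = of_w_coeffs (\<lambda>n. toeplitz_disk_adj \<phi> (w_coeff g n))"
  \<comment> \<open>One constant \<open>C\<close> bounds the adjoint on all w-coefficients, so the
    squared norms stay summable.\<close>
  have s: "summable (\<lambda>n. (ip_norm H2_inner (toeplitz_disk_adj \<phi> (w_coeff g n)))\<^sup>2)"
    by (rule summable_comparison_test'[OF summable_mult[OF H2_bidiskD(3)[OF g], of "C\<^sup>2"]])
       (simp add: adj)
  note h = of_w_coeffs[of "\<lambda>n. toeplitz_disk_adj \<phi> (w_coeff g n)", OF adj(1) s, folded h_def]
  have inner: "H2_bidisk_inner (toeplitz_bidisk \<phi> f) g = H2_bidisk_inner f h" if f: "f \<in> H2_bidisk" for f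
    unfolding H2_bidisk_inner_def h w_coeff_toeplitz[OF f] adj(2)[OF H2_bidiskD(2)[OF f]] ..
  have "toeplitz_bidisk_adj \<phi> g = h"
    unfolding toeplitz_bidisk_adj_def adjoint_on_def
  proof (rule the_equality)
    show "h \<in> H2_bidisk \<and> (\<forall>f\<in>H2_bidisk. H2_bidisk_inner (toeplitz_bidisk \<phi> f) g = H2_bidisk_inner f h)"
      using h inner by blast
    fix h' assume h': "h' \<in> H2_bidisk \<and>
      (\<forall>f\<in>H2_bidisk. H2_bidisk_inner (toeplitz_bidisk \<phi> f) g = H2_bidisk_inner f h')"
    show "h' = h"
    proof (rule H2_bidisk_eqI)
      fix m
      show "w_coeff h' m = w_coeff h m"
      proof (rule H2_eqI)
        fix k
        obtain e where e: "e \<in> H2" "\<And>h. H2_inner e h = cnj (taylor_coeff h k)"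
          using H2_coordinate[of k] by metis
        have "H2_bidisk_inner (embed_w m e) h' = H2_bidisk_inner (embed_w m e) h"
          using h' inner embed_w(1)[OF e(1), of m] by metis
        then show "taylor_coeff (w_coeff h' m) k = taylor_coeff (w_coeff h m) k"
          by (simp add: H2_bidisk_inner_embed e)
      qed (use h h' H2_bidiskD in blast)+
    qed (use h h' in auto)
  qed
  then show ?thesis using h by simp
qed

text \<open>The squared norm on the bidisk is a sum of squared norms, and one term is at most the
  sum. The resulting continuity of the n-th coefficient makes preimages of closed sets
  closed.\<close>

lemma ip_norm_w_coeff_diff_le:
  assumes "f \<in> H2_bidisk" "g \<in> H2_bidisk"
  shows "ip_norm H2_inner (w_coeff f n - w_coeff g n) \<le> ip_norm H2_bidisk_inner (f - g)"
proof -
  define d where "d = (\<lambda>m. (ip_norm H2_inner (w_coeff f m - w_coeff g m))\<^sup>2)"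
  note H = H2_bidiskD(2)[OF assms(1)] H2_bidiskD(2)[OF assms(2)]
  have s: "summable d"
    unfolding d_def
    by (rule summable_comparison_test'[OF summable_add[OF summable_mult[OF H2_bidiskD(3)[OF assms(1)], of 2]
        summable_mult[OF H2_bidiskD(3)[OF assms(2)], of 2]]])
       (simp add: H2_norm_diff_le H)
  have "H2_bidisk_inner (f - g) (f - g) = (\<Sum>m. of_real (d m))"
    unfolding H2_bidisk_inner_def w_coeff_diff[OF assms] d_def
    by (simp only: H2_inner_self(1)[OF H2_diff(1)[OF H]])
  also have "\<dots> = of_real (\<Sum>m. d m)" by (rule suminf_of_real[OF s, symmetric])
  finally have e: "ip_norm H2_bidisk_inner (f - g) = sqrt (\<Sum>m. d m)" by (simp add: ip_norm_def)
  have "d n \<le> (\<Sum>m. d m)" using sum_le_suminf[OF s, of "{n}"] by (simp add: d_def)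
  then have "sqrt (d n) \<le> sqrt (\<Sum>m. d m)" by simp
  moreover have "ip_norm H2_inner (w_coeff f n - w_coeff g n) \<le> sqrt (d n)" by (simp add: d_def)
  ultimately show ?thesis unfolding e by linarith
qed

section \<open>Lifting an invariant subspace from the disk to the bidisk\<close>

lemma norm_closedD:
  assumes "norm_closed W ip V" "\<And>k::nat. s k \<in> V" "f \<in> W" "(\<lambda>k. ip_norm ip (s k - f)) \<longlonglongrightarrow> 0"
  shows "f \<in> V"
  using assms unfolding norm_closed_def by blast

theorem theorem14:
  fixes \<phi> :: "complex \<Rightarrow> complex"
    and M :: "(complex \<times> complex \<Rightarrow> complex) set"
    and n :: nat
  assumes "\<phi> \<in> Hinf"
    and "invariant_subspace H2_bidisk H2_bidisk_inner (toeplitz_bidisk_adj \<phi>) M"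
    and "norm_closed H2_bidisk H2_bidisk_inner (proj_w n ` M)"
    and "infinite_dimensional (proj_w n ` M)"
    and "\<And>V. invariant_subspace H2 H2_inner (toeplitz_disk_adj \<phi>) V \<Longrightarrow> infinite_dimensional V \<Longrightarrow>
           has_nontrivial_invariant_subspace V H2_inner (toeplitz_disk_adj \<phi>)"
  shows "has_nontrivial_invariant_subspace M H2_bidisk_inner (toeplitz_bidisk_adj \<phi>)"
proof -
  let ?T = "toeplitz_bidisk_adj \<phi>" and ?t = "toeplitz_disk_adj \<phi>"
  let ?c = "\<lambda>g. w_coeff g n"
  define V where "V = ?c ` M"
  have M: "cfun.subspace M" "M \<subseteq> H2_bidisk" "?T ` M \<subseteq> M"
    using assms(2) by (auto simp: invariant_subspace_def norm_closed_def)
  have VH: "V \<subseteq> H2" using M(2) H2_bidiskD(2) by (auto simp: V_def)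
  have proj: "proj_w n ` M = embed_w n ` V"
    by (simp add: V_def image_image proj_w_eq_embed)
  have "cfun.subspace V"
  proof (rule cfun.subspaceI)
    show "0 \<in> V" unfolding V_def using cfun.subspace_0[OF M(1)] w_coeff_zero[of n] by (metis imageI)
    show "x + y \<in> V" if "x \<in> V" "y \<in> V" for x y
    proof -
      from that obtain f g where "f \<in> M" "g \<in> M" "x = ?c f" "y = ?c g" by (auto simp: V_def)
      then show ?thesis
        using M(2) w_coeff_add[of f g n] cfun.subspace_add[OF M(1), of f g]
        unfolding V_def by (metis imageI subsetD)
    qed
    show "cscale c x \<in> V" if "x \<in> V" for c x
    proof -
      from that obtain f where "f \<in> M" "x = ?c f" by (auto simp: V_def)
      then show ?thesis
        using M(2) w_coeff_cscale[of f c n] cfun.subspace_scale[OF M(1), of f c]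
        unfolding V_def by (metis imageI subsetD)
    qed
  qed
  \<comment> \<open>Closedness of P_n(M) is pulled back along the isometry \<open>embed_w n\<close>.
    Its injectivity, seen by taking the n-th w-coefficient, returns the limit to
    \<open>V\<close>.\<close>
  moreover have "norm_closed H2 H2_inner V"
    unfolding norm_closed_def
  proof (intro conjI VH allI impI, elim conjE)
    fix s f assume s: "\<forall>k::nat. s k \<in> V" and f: "f \<in> H2"
      and lim: "(\<lambda>k. ip_norm H2_inner (s k - f)) \<longlonglongrightarrow> 0"
    have "s k - f \<in> H2" for k using s VH f H2_diff(1) by blast
    then have "(\<lambda>k. ip_norm H2_bidisk_inner (embed_w n (s k) - embed_w n f)) \<longlonglongrightarrow> 0"
      using lim by (simp add: embed_w_diff ip_norm_embed)
    moreover have "\<forall>k. embed_w n (s k) \<in> proj_w n ` M" unfolding proj using s by blast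
    ultimately have "embed_w n f \<in> proj_w n ` M"
      using norm_closedD[OF assms(3) _ embed_w(1)[OF f]] by metis
    then obtain v where v: "v \<in> V" "embed_w n f = embed_w n v" unfolding proj by blast
    then have "f = v" using embed_w(2)[OF f, of n n] embed_w(2)[of v n n] VH by auto
    with v show "f \<in> V" by simp
  qed
  moreover have cT: "?c (?T g) = ?t (?c g)" if "g \<in> M" for g
    using toeplitz_bidisk_adj[OF assms(1)] that M(2) by blast
  then have "?t ` V \<subseteq> V"
    unfolding V_def using M(3) by (auto simp: cT[symmetric])
  ultimately have inv: "invariant_subspace H2 H2_inner ?t V" by (simp add: invariant_subspace_def)
  \<comment> \<open>\<open>embed_w n\<close> is linear, so a finite spanning set of \<open>V\<close>
    would map to one of P_n(M).\<close>
  have "infinite_dimensional V"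
    unfolding infinite_dimensional_def
  proof
    interpret E: module_hom cscale cscale "embed_w n"
      by unfold_locales (auto simp: embed_w_def cscale_def fun_eq_iff algebra_simps)
    assume "\<exists>B. finite B \<and> B \<subseteq> V \<and> cfun.span B = V"
    then obtain B where "finite B" "B \<subseteq> V" "cfun.span B = V" by blast
    then have "finite (embed_w n ` B)" "embed_w n ` B \<subseteq> embed_w n ` V"
      "cfun.span (embed_w n ` B) = embed_w n ` V"
      using E.span_image[of B] by auto
    then show False using assms(4) unfolding proj infinite_dimensional_def by blast
  qed
  from assms(5)[OF inv this] obtain N where N: "invariant_subspace V H2_inner ?t N" "N \<noteq> {0}" "N \<noteq> V"
    by (auto simp: has_nontrivial_invariant_subspace_def)
  have N': "cfun.subspace N" "N \<subseteq> V" "?t ` N \<subseteq> N" "norm_closed V H2_inner N"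
    using N(1) by (auto simp: invariant_subspace_def norm_closed_def)
  define L where "L = {g \<in> M. ?c g \<in> N}"
  have LM: "L \<subseteq> M" by (auto simp: L_def)
  have "cfun.subspace L"
  proof (rule cfun.subspaceI)
    show "0 \<in> L" using cfun.subspace_0[OF M(1)] cfun.subspace_0[OF N'(1)] by (simp add: L_def w_coeff_zero)
    show "x + y \<in> L" if "x \<in> L" "y \<in> L" for x y
      using that M(2) cfun.subspace_add[OF M(1)] cfun.subspace_add[OF N'(1)]
      by (auto simp: L_def w_coeff_add subset_iff)
    show "cscale c x \<in> L" if "x \<in> L" for c x
      using that M(2) cfun.subspace_scale[OF M(1)] cfun.subspace_scale[OF N'(1)]
      by (auto simp: L_def w_coeff_cscale subset_iff)
  qed
  moreover have "norm_closed M H2_bidisk_inner L"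
    unfolding norm_closed_def
  proof (intro conjI LM allI impI, elim conjE)
    fix s f assume s: "\<forall>k::nat. s k \<in> L" and f: "f \<in> M"
      and lim: "(\<lambda>k. ip_norm H2_bidisk_inner (s k - f)) \<longlonglongrightarrow> 0"
    have le: "ip_norm H2_inner (?c (s k) - ?c f) \<le> ip_norm H2_bidisk_inner (s k - f)" for k
      using s f LM M(2) by (intro ip_norm_w_coeff_diff_le) auto
    \<comment> \<open>\<open>sqrt\<close> is negative on negative reals, so the sign has to come
      from the inner product of an \<open>H2\<close> function with itself.\<close>
    have nonneg: "0 \<le> ip_norm H2_inner (?c (s k) - ?c f)" for k
    proof -
      have "?c (s k) - ?c f \<in> H2" using s f LM M(2) by (intro H2_diff H2_bidiskD) auto
      from H2_inner_self(1)[OF this] show ?thesis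
        unfolding ip_norm_def by (metis Re_complex_of_real real_sqrt_ge_zero zero_le_power2)
    qed
    have lim': "(\<lambda>k. ip_norm H2_inner (?c (s k) - ?c f)) \<longlonglongrightarrow> 0"
      by (rule tendsto_sandwich[OF always_eventually always_eventually tendsto_const lim])
         (use le nonneg in simp_all)
    have sN: "?c (s k) \<in> N" for k using s by (simp add: L_def)
    \<comment> \<open>\<open>N\<close> is given as closed relative to \<open>V\<close>, so the limit
      must first be placed in \<open>V\<close>.\<close>
    have "?c f \<in> V" using f by (simp add: V_def)
    from norm_closedD[OF N'(4) sN this lim'] have "?c f \<in> N" .
    with f show "f \<in> L" by (simp add: L_def)
  qed
  moreover have "?T ` L \<subseteq> L"
    using M(3) N'(3) by (auto simp: L_def cT)
  \<comment> \<open>A nonzero element of \<open>N\<close> is the n-th coefficient of some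
    \<open>g\<close> in \<open>M\<close>, and \<open>g\<close> cannot be zero.\<close>
  moreover have "L \<noteq> {0}"
  proof -
    obtain x where "x \<in> N" "x \<noteq> 0" using N(2) cfun.subspace_0[OF N'(1)] by blast
    then obtain g where "g \<in> M" "x = ?c g" using N'(2) by (auto simp: V_def)
    with \<open>x \<in> N\<close> \<open>x \<noteq> 0\<close> have "g \<in> L" "g \<noteq> 0" using w_coeff_zero[of n] by (auto simp: L_def)
    then show ?thesis by blast
  qed
  \<comment> \<open>If \<open>L\<close> were all of \<open>M\<close>, every n-th coefficient would
    lie in \<open>N\<close>, forcing \<open>N = V\<close>.\<close>
  moreover have "L \<noteq> M" using N(3) N'(2) by (auto simp: L_def V_def)
  ultimately show ?thesis
    unfolding has_nontrivial_invariant_subspace_def invariant_subspace_def by blast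
qed

end
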